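(* Let $\ell^{n}=\{M,H\}$ be a Cartan space with $(\alpha,\beta)$-metric whose fundamental function is $H(\alpha,\beta)=\dfrac{\alpha\beta^{2}}{\beta-\alpha}$, considered on the region $U\subset T^{*}M\setminus\{0\}$. Then its invariants are $$\rho_{1}=\frac{\alpha\beta^{2}-2\alpha^{2}\beta}{2(\beta-\alpha)^{2}},\quad \rho=\frac{\beta^{3}}{2\alpha(\beta-\alpha)^{2}},\quad \rho_{0}=\frac{\alpha^{3}}{(\beta-\alpha)^{3}},\quad \rho_{-1}=\frac{\beta^{3}-3\alpha\beta^{2}}{2\alpha(\beta-\alpha)^{3}},\quad \rho_{-2}=\frac{\beta^{3}(3\alpha-\beta)}{2\alpha^{3}(\beta-\alpha)^{3}},$$ $$r_{-1}=\frac{-3\alpha^{3}}{(\beta-\alpha)^{4}},\quad r_{-2}=\frac{3\alpha\beta}{(\beta-\alpha)^{4}},\quad r_{-3}=\frac{4\alpha\beta^{3}-\beta^{4}-9\alpha^{2}\beta^{2}}{2\alpha^{3}(\beta-\alpha)^{4}},\quad r_{-4}=\frac{15\alpha^{2}\beta^{3}+3\beta^{5}-12\alpha\beta^{4}}{2\alpha^{5}(\beta-\alpha)^{4}},$$ and they satisfy the relations $$\alpha^{2}\rho_{-1}+\beta\rho_{0}=\rho_{1},\qquad \alpha^{2}\rho_{-2}+\beta\rho_{-1}=0,$$ $$\alpha^{2}r_{-2}+\beta r_{-1}=0,\qquad \alpha^{2}r_{-3}+\beta r_{-2}=-\rho_{-1},\qquad \alpha^{2}r_{-4}+\beta r_{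-3}=-2\rho_{-2}.$$
   Context: $M$ is an $n$-dimensional smooth manifold, $(x,y)=(x^i,y_i)$ are the canonical coordinates on $T^{*}M$, and summation over repeated indices is understood. $a^{ij}(x)$ is a (contravariant) Riemannian metric on $M$, $b^{i}(x)$ a vector field on $M$, and $\alpha(x,y)=\sqrt{a^{ij}(x)y_iy_j}$, $\beta(x,y)=b^{i}(x)y_i$. $U$ denotes the region of $T^{*}M\setminus\{0\}$ (zero section removed) where $\beta>0$ and $\alpha<\beta$. A Cartan space $\ell^{n}=\{M,H(x,y)\}$ is given by a fundamental function $H(x,y)$ positively homogeneous of degree $2$ in $y$ whose fundamental tensor $g^{ij}=\frac12\frac{\partial^2 H}{\partial y_i\partial y_j}$ is nondegenerate. It is a Cartan space with $(\alpha,\beta)$-metric if $H(x,y)=H(\alpha(x,y),\beta(x,y))$ is a function of $\alpha$ and $\beta$ only. Subscripts on $H$ denote partial derivatives of $H(\alpha,\beta)$. The invariants of a Cartan space with $(\alpha,\beta)$-metric are $$\rho_{1}=\tfrac12H_{\beta},\quad \rho=\tfrac{1}{2\alpha}H_{\alpha},\quad \rho_{0}=\tfrac12H_{\beta\beta},\quad \rho_{-1}=\tfrac{1}{2\alpha}H_{\alpha\beta},\quad \rho_{-2}=\tfrac{1}{2\alpha^{2}}\left(H_{\alpha\alpha}-\alpha^{-1}H_{\alpha}\right),$$ $$r_{-1}=\tfrac12H_{\beta\beta\beta},\quad r_{-2}=\tfrac{1}{2\alpha}H_{\alpha\beta\beta},\quad r_{-3}=\tfrac{1}{2\alpha^{2}}\left(H_{\alpha\alpha\beta}-\alpha^{-1}H_{\alpha\beta}\right),\quad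 r_{-4}=\tfrac{1}{2\alpha^{3}}\left(H_{\alpha\alpha\alpha}-3\alpha^{-1}H_{\alpha\alpha}+3\alpha^{-2}H_{\alpha}\right).$$ *)

theory Defs
  imports "HOL-Analysis.Analysis"
begin

section \<open>Smooth manifolds\<close>

text \<open>
  \<open>C\<^sup>k\<close> maps, meant for open \<open>S\<close>.
\<close>

primrec Ck_on :: "nat \<Rightarrow> ('a::real_normed_vector \<Rightarrow> 'b::real_normed_vector) \<Rightarrow> 'a set \<Rightarrow> bool" where
  "Ck_on 0 f S \<longleftrightarrow> continuous_on S f"
| "Ck_on (Suc k) f S \<longleftrightarrow>
     f differentiable_on S \<and> (\<forall>v. Ck_on k (\<lambda>x. frechet_derivative f (at x) v) S)"

definition smooth_on :: "('a::real_normed_vector \<Rightarrow> 'b::real_normed_vector) \<Rightarrow> 'a set \<Rightarrow> bool" where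
  "smooth_on f S \<longleftrightarrow> (\<forall>k. Ck_on k f S)"

text \<open>
  The manifold \<open>M\<close> is the whole type \<open>'m\<close>, its dimension is \<open>CARD('n)\<close>. A chart is a domain
  together with a coordinate map, whose values outside the domain are irrelevant. The smooth
  structure is given by an atlas, which need not be maximal.
\<close>

type_synonym ('m, 'n) chart = "'m set \<times> ('m \<Rightarrow> real ^ 'n)"

definition chart_inv :: "('m, 'n::finite) chart \<Rightarrow> real ^ 'n \<Rightarrow> 'm" where
  "chart_inv c = inv_into (fst c) (snd c)"

definition chart :: "('m::topological_space, 'n::finite) chart \<Rightarrow> bool" where
  "chart c \<longleftrightarrow> open (fst c) \<and> open (snd c ` fst c) \<and>
     homeomorphism (fst c) (snd c ` fst c) (snd c) (chart_inv c)"

definition transition :: "('m, 'n::finite) chart \<Rightarrow> ('m, 'n) chart \<Rightarrow> real ^ 'n \<Rightarrow> real ^ 'n" where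
  "transition c d = snd d \<circ> chart_inv c"

definition smooth_atlas ::
    "('m::{t2_space, second_countable_topology}, 'n::finite) chart set \<Rightarrow> bool" where
  "smooth_atlas A \<longleftrightarrow> (\<forall>c\<in>A. chart c) \<and> (\<Union>c\<in>A. fst c) = UNIV \<and>
     (\<forall>c\<in>A. \<forall>d\<in>A. smooth_on (transition c d) (snd c ` (fst c \<inter> fst d)))"

text \<open>\<open>jac c d p $ j $ i\<close> is the derivative of the \<open>j\<close>-th coordinate of \<open>d\<close> with respect to the
  \<open>i\<close>-th coordinate of \<open>c\<close>, at the point \<open>p\<close>.\<close>

definition jac :: "('m, 'n::finite) chart \<Rightarrow> ('m, 'n) chart \<Rightarrow> 'm \<Rightarrow> real ^ 'n ^ 'n" where
  "jac c d p = jacobian (transition c d) (at (snd c p))"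


section \<open>The cotangent bundle and tensor fields\<close>

text \<open>
  A covector at \<open>p\<close> is the family of its component vectors \<open>\<omega> c = (y\<^sub>i)\<close> in the charts \<open>c\<close> of the
  atlas around \<open>p\<close>, subject to the covariant transformation law; it is set to \<open>0\<close> at all other
  charts. The canonical coordinates of \<open>(p, \<omega>)\<close> belonging to \<open>c\<close> are thus \<open>(snd c p, \<omega> c)\<close>.
\<close>

type_synonym ('m, 'n) covector = "('m, 'n) chart \<Rightarrow> real ^ 'n"

definition cotangent_space ::
    "('m, 'n::finite) chart set \<Rightarrow> 'm \<Rightarrow> ('m, 'n) covector set" where
  "cotangent_space A p = {\<omega>.
     (\<forall>c. \<not> (c \<in> A \<and> p \<in> fst c) \<longrightarrow> \<omega> c = 0) \<and>
     (\<forall>c\<in>A. \<forall>d\<in>A. p \<in> fst c \<inter> fst d \<longrightarrow> \<omega> c = transpose (jac c d p) *v \<omega> d)}"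

definition slit_cotangent_bundle ::
    "('m, 'n::finite) chart set \<Rightarrow> ('m \<times> ('m, 'n) covector) set" where
  "slit_cotangent_bundle A = {(p, \<omega>). \<omega> \<in> cotangent_space A p \<and> \<omega> \<noteq> (\<lambda>_. 0)}"

text \<open>The covector at \<open>p\<close> whose components in the chart \<open>c\<close> are \<open>y\<close>
  (see \<open>covec_in_cotangent_space\<close> and \<open>covec_component\<close> below).\<close>

definition covec ::
    "('m, 'n::finite) chart set \<Rightarrow> ('m, 'n) chart \<Rightarrow> 'm \<Rightarrow> real ^ 'n \<Rightarrow> ('m, 'n) covector" where
  "covec A c p y =
     (\<lambda>d. if d \<in> A \<and> p \<in> fst d then transpose (jac d c p) *v y else 0)"

text \<open>Tensor fields are given by their components \<open>a c p\<close>, \<open>b c p\<close> in each chart \<open>c\<close>.\<close>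

type_synonym ('m, 'n) cometric_field = "('m, 'n) chart \<Rightarrow> 'm \<Rightarrow> real ^ 'n ^ 'n"
type_synonym ('m, 'n) vector_field = "('m, 'n) chart \<Rightarrow> 'm \<Rightarrow> real ^ 'n"

definition riemannian_cometric ::
    "('m, 'n::finite) chart set \<Rightarrow> ('m, 'n) cometric_field \<Rightarrow> bool" where
  "riemannian_cometric A a \<longleftrightarrow> (\<forall>c\<in>A.
     smooth_on (\<lambda>x. a c (chart_inv c x)) (snd c ` fst c) \<and>
     (\<forall>p\<in>fst c. transpose (a c p) = a c p \<and> (\<forall>y. y \<noteq> 0 \<longrightarrow> y \<bullet> (a c p *v y) > 0)) \<and>
     (\<forall>d\<in>A. \<forall>p\<in>fst c \<inter> fst d. a d p = jac c d p ** a c p ** transpose (jac c d p)))"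

definition smooth_vector_field ::
    "('m, 'n::finite) chart set \<Rightarrow> ('m, 'n) vector_field \<Rightarrow> bool" where
  "smooth_vector_field A b \<longleftrightarrow> (\<forall>c\<in>A.
     smooth_on (\<lambda>x. b c (chart_inv c x)) (snd c ` fst c) \<and>
     (\<forall>d\<in>A. \<forall>p\<in>fst c \<inter> fst d. b d p = jac c d p *v b c p))"

text \<open>\<open>\<alpha>\<close> and \<open>\<beta>\<close> as functions on the cotangent bundle. They are computed in some chart of the
  atlas around \<open>p\<close>; \<open>alpha_eq\<close> and \<open>beta_eq\<close> below show that every chart gives the same value.\<close>

definition chart_at :: "('m, 'n) chart set \<Rightarrow> 'm \<Rightarrow> ('m, 'n) chart" where
  "chart_at A p = (SOME c. c \<in> A \<and> p \<in> fst c)"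

definition alpha ::
    "('m, 'n::finite) chart set \<Rightarrow> ('m, 'n) cometric_field \<Rightarrow> 'm \<Rightarrow> ('m, 'n) covector \<Rightarrow> real" where
  "alpha A a p \<omega> = (let c = chart_at A p in
     sqrt (\<Sum>i\<in>UNIV. \<Sum>j\<in>UNIV. a c p $ i $ j * \<omega> c $ i * \<omega> c $ j))"

definition beta ::
    "('m, 'n::finite) chart set \<Rightarrow> ('m, 'n) vector_field \<Rightarrow> 'm \<Rightarrow> ('m, 'n) covector \<Rightarrow> real" where
  "beta A b p \<omega> = (let c = chart_at A p in \<Sum>i\<in>UNIV. b c p $ i * \<omega> c $ i)"

definition ab_region ::
    "('m, 'n::finite) chart set \<Rightarrow> ('m, 'n) cometric_field \<Rightarrow> ('m, 'n) vector_field \<Rightarrow>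
     ('m \<times> ('m, 'n) covector) set" where
  "ab_region A a b = {(p, \<omega>) \<in> slit_cotangent_bundle A.
     beta A b p \<omega> > 0 \<and> alpha A a p \<omega> < beta A b p \<omega>}"


section \<open>Cartan spaces\<close>

definition partial_deriv :: "'n::finite \<Rightarrow> (real ^ 'n \<Rightarrow> real) \<Rightarrow> real ^ 'n \<Rightarrow> real" where
  "partial_deriv i f y = deriv (\<lambda>t. f (y + t *\<^sub>R axis i 1)) 0"

definition fundamental_tensor ::
    "('m, 'n::finite) chart set \<Rightarrow> ('m \<Rightarrow> ('m, 'n) covector \<Rightarrow> real) \<Rightarrow>
     ('m, 'n) chart \<Rightarrow> 'm \<Rightarrow> ('m, 'n) covector \<Rightarrow> real ^ 'n ^ 'n" where
  "fundamental_tensor A H c p \<omega> =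
     (\<chi> i j. 1/2 * partial_deriv i (partial_deriv j (\<lambda>y. H p (covec A c p y))) (\<omega> c))"

text \<open>The region \<open>D\<close> of the cotangent bundle in the canonical coordinates \<open>(x, y)\<close> of \<open>c\<close>.\<close>

definition in_coords ::
    "('m, 'n::finite) chart set \<Rightarrow> ('m \<times> ('m, 'n) covector) set \<Rightarrow> ('m, 'n) chart \<Rightarrow>
     ((real ^ 'n) \<times> (real ^ 'n)) set" where
  "in_coords A D c = {(x, y). x \<in> snd c ` fst c \<and>
     (chart_inv c x, covec A c (chart_inv c x) y) \<in> D}"

text \<open>A Cartan space whose fundamental function \<open>H\<close> is considered on an open conic region \<open>D\<close> of the
  slit cotangent bundle; the values of \<open>H\<close> outside \<open>D\<close> are irrelevant.\<close>

definition cartan_space ::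
    "('m::{t2_space, second_countable_topology}, 'n::finite) chart set \<Rightarrow>
     ('m \<times> ('m, 'n) covector) set \<Rightarrow> ('m \<Rightarrow> ('m, 'n) covector \<Rightarrow> real) \<Rightarrow> bool" where
  "cartan_space A D H \<longleftrightarrow>
     smooth_atlas A \<and>
     D \<subseteq> slit_cotangent_bundle A \<and>
     (\<forall>c\<in>A. open (in_coords A D c) \<and>
        smooth_on (\<lambda>(x, y). H (chart_inv c x) (covec A c (chart_inv c x) y)) (in_coords A D c)) \<and>
     (\<forall>(p, \<omega>)\<in>D. \<forall>t>0. (p, \<lambda>c. t *\<^sub>R \<omega> c) \<in> D \<and> H p (\<lambda>c. t *\<^sub>R \<omega> c) = t\<^sup>2 * H p \<omega>) \<and>
     (\<forall>(p, \<omega>)\<in>D. \<forall>c\<in>A. p \<in> fst c \<longrightarrow> det (fundamental_tensor A H c p \<omega>) \<noteq> 0)"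

definition cartan_space_ab ::
    "('m::{t2_space, second_countable_topology}, 'n::finite) chart set \<Rightarrow>
     ('m \<times> ('m, 'n) covector) set \<Rightarrow> ('m, 'n) cometric_field \<Rightarrow> ('m, 'n) vector_field \<Rightarrow>
     (real \<Rightarrow> real \<Rightarrow> real) \<Rightarrow> ('m \<Rightarrow> ('m, 'n) covector \<Rightarrow> real) \<Rightarrow> bool" where
  "cartan_space_ab A D a b h H \<longleftrightarrow>
     cartan_space A D H \<and> riemannian_cometric A a \<and> smooth_vector_field A b \<and>
     (\<forall>(p, \<omega>)\<in>D. H p \<omega> = h (alpha A a p \<omega>) (beta A b p \<omega>))"


section \<open>The invariants\<close>

text \<open>Partial derivatives of a function \<open>h\<close> of the two variables \<open>\<alpha>\<close>, \<open>\<beta>\<close>. In mixed derivatives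
  the \<open>\<alpha>\<close>-derivatives are taken first.\<close>

definition d_alpha :: "(real \<Rightarrow> real \<Rightarrow> real) \<Rightarrow> real \<Rightarrow> real \<Rightarrow> real" where
  "d_alpha h s t = deriv (\<lambda>u. h u t) s"

definition d_beta :: "(real \<Rightarrow> real \<Rightarrow> real) \<Rightarrow> real \<Rightarrow> real \<Rightarrow> real" where
  "d_beta h s t = deriv (\<lambda>u. h s u) t"

definition rho1 :: "(real \<Rightarrow> real \<Rightarrow> real) \<Rightarrow> real \<Rightarrow> real \<Rightarrow> real" where
  "rho1 h s t = 1/2 * d_beta h s t"

definition rho :: "(real \<Rightarrow> real \<Rightarrow> real) \<Rightarrow> real \<Rightarrow> real \<Rightarrow> real" where
  "rho h s t = 1 / (2 * s) * d_alpha h s t"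

definition rho0 :: "(real \<Rightarrow> real \<Rightarrow> real) \<Rightarrow> real \<Rightarrow> real \<Rightarrow> real" where
  "rho0 h s t = 1/2 * d_beta (d_beta h) s t"

definition rho_minus1 :: "(real \<Rightarrow> real \<Rightarrow> real) \<Rightarrow> real \<Rightarrow> real \<Rightarrow> real" where
  "rho_minus1 h s t = 1 / (2 * s) * d_beta (d_alpha h) s t"

definition rho_minus2 :: "(real \<Rightarrow> real \<Rightarrow> real) \<Rightarrow> real \<Rightarrow> real \<Rightarrow> real" where
  "rho_minus2 h s t = 1 / (2 * s\<^sup>2) * (d_alpha (d_alpha h) s t - 1 / s * d_alpha h s t)"

definition r_minus1 :: "(real \<Rightarrow> real \<Rightarrow> real) \<Rightarrow> real \<Rightarrow> real \<Rightarrow> real" where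
  "r_minus1 h s t = 1/2 * d_beta (d_beta (d_beta h)) s t"

definition r_minus2 :: "(real \<Rightarrow> real \<Rightarrow> real) \<Rightarrow> real \<Rightarrow> real \<Rightarrow> real" where
  "r_minus2 h s t = 1 / (2 * s) * d_beta (d_beta (d_alpha h)) s t"

definition r_minus3 :: "(real \<Rightarrow> real \<Rightarrow> real) \<Rightarrow> real \<Rightarrow> real \<Rightarrow> real" where
  "r_minus3 h s t =
     1 / (2 * s\<^sup>2) * (d_beta (d_alpha (d_alpha h)) s t - 1 / s * d_beta (d_alpha h) s t)"

definition r_minus4 :: "(real \<Rightarrow> real \<Rightarrow> real) \<Rightarrow> real \<Rightarrow> real \<Rightarrow> real" where
  "r_minus4 h s t =
     1 / (2 * s ^ 3) * (d_alpha (d_alpha (d_alpha h)) s t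
       - 3 / s * d_alpha (d_alpha h) s t + 3 / s\<^sup>2 * d_alpha h s t)"


section \<open>Independence of the chart\<close>

lemma chart_at:
  assumes "c \<in> A" "p \<in> fst c"
  shows "chart_at A p \<in> A" "p \<in> fst (chart_at A p)"
  using someI[of "\<lambda>c. c \<in> A \<and> p \<in> fst c" c] assms unfolding chart_at_def by auto

lemma quadratic_form_eq:
  fixes M :: "real ^ 'n::finite ^ 'n"
  shows "(\<Sum>i\<in>UNIV. \<Sum>j\<in>UNIV. M $ i $ j * y $ i * y $ j) = y \<bullet> (M *v y)"
  by (simp add: inner_vec_def matrix_vector_mult_def sum_distrib_left mult_ac)

lemma alpha_eq:
  assumes "riemannian_cometric A a" "\<omega> \<in> cotangent_space A p" "c \<in> A" "p \<in> fst c"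
  shows "alpha A a p \<omega> = sqrt (\<Sum>i\<in>UNIV. \<Sum>j\<in>UNIV. a c p $ i $ j * \<omega> c $ i * \<omega> c $ j)"
proof -
  define d where "d = chart_at A p"
  have d: "d \<in> A" "p \<in> fst d"
    using chart_at[OF assms(3,4)] by (simp_all add: d_def)
  define J where "J = jac c d p"
  have a: "a d p = J ** a c p ** transpose J"
    using assms(1,3,4) d unfolding riemannian_cometric_def J_def by blast
  have y: "\<omega> c = transpose J *v \<omega> d"
    using assms(2,3,4) d unfolding cotangent_space_def J_def by blast
  have "\<omega> d \<bullet> (a d p *v \<omega> d) = \<omega> d \<bullet> (J *v (a c p *v \<omega> c))"
    by (simp add: a y matrix_vector_mul_assoc matrix_mul_assoc del: transpose_matrix_vector)
  also have "\<dots> = \<omega> c \<bullet> (a c p *v \<omega> c)"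
    by (simp add: y dot_lmul_matrix)
  finally show ?thesis
    by (simp add: alpha_def Let_def quadratic_form_eq flip: d_def)
qed

lemma beta_eq:
  assumes "smooth_vector_field A b" "\<omega> \<in> cotangent_space A p" "c \<in> A" "p \<in> fst c"
  shows "beta A b p \<omega> = (\<Sum>i\<in>UNIV. b c p $ i * \<omega> c $ i)"
proof -
  define d where "d = chart_at A p"
  have d: "d \<in> A" "p \<in> fst d"
    using chart_at[OF assms(3,4)] by (simp_all add: d_def)
  define J where "J = jac c d p"
  have b: "b d p = J *v b c p"
    using assms(1,3,4) d unfolding smooth_vector_field_def J_def by blast
  have y: "\<omega> c = transpose J *v \<omega> d"
    using assms(2,3,4) d unfolding cotangent_space_def J_def by blast
  have "\<omega> d \<bullet> b d p = \<omega> c \<bullet> b c p"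
    by (simp add: b y dot_lmul_matrix)
  then show ?thesis
    by (simp add: beta_def Let_def inner_vec_def mult.commute flip: d_def)
qed

lemma chart_inv [simp]: "chart c \<Longrightarrow> p \<in> fst c \<Longrightarrow> chart_inv c (snd c p) = p"
  unfolding chart_def homeomorphism_def by blast

lemma open_chart_image:
  assumes "chart c" "open W" "W \<subseteq> fst c"
  shows "open (snd c ` W)"
proof -
  have "openin (top_of_set (snd c ` fst c)) (snd c ` W)"
    using assms unfolding chart_def
    by (meson homeomorphism_imp_open_map open_subset)
  then show ?thesis
    using assms(1) unfolding chart_def by (meson openin_open_trans)
qed

lemma transition_has_derivative:
  assumes "smooth_atlas A" "c \<in> A" "d \<in> A" "p \<in> fst c \<inter> fst d"
  shows "(transition c d has_derivative (*v) (jac c d p)) (at (snd c p))"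
proof -
  have "chart c" "chart d" "smooth_on (transition c d) (snd c ` (fst c \<inter> fst d))"
    using assms unfolding smooth_atlas_def by auto
  moreover have "open (snd c ` (fst c \<inter> fst d))"
    using calculation by (intro open_chart_image) (auto simp: chart_def)
  moreover have "transition c d differentiable_on (snd c ` (fst c \<inter> fst d))"
    using calculation(3) Ck_on.simps(2) unfolding smooth_on_def by blast
  ultimately have "transition c d differentiable (at (snd c p))"
    using assms(4) by (metis differentiable_on_eq_differentiable_at imageI)
  then show ?thesis
    unfolding jac_def using jacobian_works by blast
qed

lemma jac_self:
  assumes "smooth_atlas A" "c \<in> A" "p \<in> fst c"
  shows "jac c c p = mat 1"
proof -
  have c: "chart c" using assms unfolding smooth_atlas_def by auto
  then have "open (snd c ` fst c)" by (simp add: chart_def)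
  moreover have "\<And>x. x \<in> snd c ` fst c \<Longrightarrow> x = transition c c x"
    using c by (auto simp: transition_def)
  ultimately have "(transition c c has_derivative (\<lambda>x. x)) (at (snd c p))"
    using assms(3) has_derivative_transform_within_open[OF has_derivative_ident] by blast
  with transition_has_derivative[OF assms(1,2,2)] assms(3)
  have "(*v) (jac c c p) = (\<lambda>x. x)"
    using has_derivative_unique by blast
  then have "matrix ((*v) (jac c c p)) = matrix (\<lambda>x. x)" by simp
  then show ?thesis
    by (simp add: matrix_id_mat_1[unfolded id_def] id_def)
qed

lemma jac_cocycle:
  assumes "smooth_atlas A" "c \<in> A" "d \<in> A" "e \<in> A" "p \<in> fst c \<inter> fst d \<inter> fst e"
  shows "jac c e p = jac d e p ** jac c d p"
proof -
  have ch: "chart c" "chart d" "chart e" using assms unfolding smooth_atlas_def by auto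
  define W where "W = snd c ` (fst c \<inter> fst d \<inter> fst e)"
  have "open W"
    unfolding W_def using ch by (intro open_chart_image) (auto simp: chart_def)
  have eq: "\<And>x. x \<in> W \<Longrightarrow> (transition d e \<circ> transition c d) x = transition c e x"
    using ch by (auto simp: transition_def W_def)
  have *: "transition c d (snd c p) = snd d p"
    using ch assms(5) by (simp add: transition_def)
  have "(transition d e \<circ> transition c d has_derivative (*v) (jac d e p) \<circ> (*v) (jac c d p))
      (at (snd c p))"
    using assms by (intro diff_chain_at) (auto simp: * intro!: transition_has_derivative)
  then have "(transition c e has_derivative (*v) (jac d e p) \<circ> (*v) (jac c d p)) (at (snd c p))"
    using has_derivative_transform_within_open[OF _ \<open>open W\<close> _ eq] assms(5)
    by (fastforce simp: W_def)
  with transition_has_derivative[OF assms(1,2,4)] assms(5)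
  have "(*v) (jac c e p) = (*v) (jac d e p) \<circ> (*v) (jac c d p)"
    using has_derivative_unique by blast
  then have "jac c e p *v x = (jac d e p ** jac c d p) *v x" for x
    by (simp add: matrix_vector_mul_assoc)
  then show ?thesis
    by (simp add: matrix_eq)
qed

lemma covec_component:
  assumes "smooth_atlas A" "c \<in> A" "p \<in> fst c"
  shows "covec A c p y c = y"
  using assms by (simp add: covec_def jac_self)

lemma covec_in_cotangent_space:
  assumes "smooth_atlas A" "c \<in> A" "p \<in> fst c"
  shows "covec A c p y \<in> cotangent_space A p"
proof -
  have "covec A c p y d = transpose (jac d e p) *v covec A c p y e"
    if "d \<in> A" "e \<in> A" "p \<in> fst d \<inter> fst e" for d e
  proof -
    have "jac d c p = jac e c p ** jac d e p"
      using assms that by (intro jac_cocycle[OF assms(1)]) auto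
    with that show ?thesis
      by (simp add: covec_def matrix_transpose_mul matrix_vector_mul_assoc
          del: transpose_matrix_vector)
  qed
  moreover have "covec A c p y d = 0" if "\<not> (d \<in> A \<and> p \<in> fst d)" for d
    using that by (auto simp: covec_def)
  ultimately show ?thesis
    unfolding cotangent_space_def mem_Collect_eq by blast
qed

end

theory Submission
  imports Defs
begin

text \<open>Positive definiteness applies in any chart where the covector has nonzero components,
  and \<open>alpha_eq\<close> carries the result to the chart chosen in
  \<open>alpha\<close>.\<close>

lemma alpha_pos:
  assumes "riemannian_cometric A a" "(p, \<omega>) \<in> slit_cotangent_bundle A"
  shows "alpha A a p \<omega> > 0"
proof -
  have \<omega>: "\<omega> \<in> cotangent_space A p" "\<omega> \<noteq> (\<lambda>_. 0)"
    using assms(2) by (auto simp: slit_cotangent_bundle_def)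
  then obtain c where c: "\<omega> c \<noteq> 0" by blast
  \<comment> \<open>Covectors have the default value \<open>0\<close> at charts outside the atlas or
    not around \<open>p\<close>, so a nonzero component vector forces \<open>c\<close> to be a
    genuine chart at \<open>p\<close>.\<close>
  with \<omega>(1) have "c \<in> A" "p \<in> fst c"
    unfolding cotangent_space_def by blast+
  moreover from this c have "\<omega> c \<bullet> (a c p *v \<omega> c) > 0"
    using assms(1) unfolding riemannian_cometric_def by blast
  ultimately show ?thesis
    using alpha_eq[OF assms(1) \<omega>(1)] by (simp add: quadratic_form_eq)
qed

text \<open>A derivative depends only on values nearby, so a formula valid on the open cone
  \<open>0 < s < t\<close> suffices. The first premise has the shape of the closed forms proved
  below, so each of them feeds the next differentiation.\<close>

lemma d_alpha_eqI:
  assumes "\<And>s t. 0 < s \<Longrightarrow> s < t \<Longrightarrow> f s t = g s t" "0 < s" "s < t"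
    and "((\<lambda>u. g u t) has_real_derivative D) (at s)"
  shows "d_alpha f s t = D"
proof -
  have "((\<lambda>u. f u t) has_real_derivative D) (at s)"
    using assms
    \<comment> \<open>For fixed \<open>t\<close> the cone is cut in this open interval; for fixed
      \<open>s\<close>, in the ray \<open>{s<..}\<close>.\<close>
    by (intro has_field_derivative_transform_within_open[OF assms(4), of "{0<..<t}"]) auto
  then show ?thesis
    unfolding d_alpha_def by (rule DERIV_imp_deriv)
qed

lemma d_beta_eqI:
  assumes "\<And>s t. 0 < s \<Longrightarrow> s < t \<Longrightarrow> f s t = g s t" "0 < s" "s < t"
    and "(g s has_real_derivative D) (at t)"
  shows "d_beta f s t = D"
proof -
  have "(f s has_real_derivative D) (at t)"
    using assms
    by (intro has_field_derivative_transform_within_open[OF assms(4), of "{s<..}"]) auto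
  then show ?thesis
    unfolding d_beta_def by (rule DERIV_imp_deriv)
qed

locale fundamental_function =
  fixes h :: "real \<Rightarrow> real \<Rightarrow> real"
  assumes h: "\<And>s t. 0 < s \<Longrightarrow> s < t \<Longrightarrow> h s t = s * t\<^sup>2 / (t - s)"
begin

text \<open>The quotient rule gives the numerator
  \<open>t\<^sup>2 * (t - s) + s * t\<^sup>2\<close>, where \<open>s\<close> cancels. Hence repeated
  \<alpha>-derivatives only differentiate a power of \<open>t - s\<close>.\<close>

lemma d_alpha_h:
  assumes "0 < s" "s < t"
  shows "d_alpha h s t = t ^ 3 / (t - s)\<^sup>2"
proof -
  have "t - s \<noteq> 0" "t \<noteq> s" using assms by auto
  then show ?thesis
    using assms
    \<comment> \<open>The differentiation rules leave an equation between the computed derivative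
      and the stated one; clearing denominators turns it into a polynomial identity.\<close>
    by (intro d_alpha_eqI[OF h])
      (auto intro!: derivative_eq_intros, simp add: divide_simps, algebra)
qed

text \<open>The right-hand side comes from \<open>h s t = s * t + s\<^sup>2 + s ^ 3 / (t - s)\<close>, which makes the higher
  pure \<open>\<beta>\<close>-derivatives monomials over powers of \<open>t - s\<close>.\<close>

lemma d_beta_h:
  assumes "0 < s" "s < t"
  shows "d_beta h s t = s - s ^ 3 / (t - s)\<^sup>2"
proof -
  have "t - s \<noteq> 0" "t \<noteq> s" using assms by auto
  then show ?thesis
    using assms
    by (intro d_beta_eqI[OF h])
      (auto intro!: derivative_eq_intros, simp add: divide_simps, algebra)
qed

lemma d_alpha_alpha_h:
  assumes "0 < s" "s < t"
  shows "d_alpha (d_alpha h) s t = 2 * t ^ 3 / (t - s) ^ 3"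
proof -
  have "t - s \<noteq> 0" "t \<noteq> s" using assms by auto
  then show ?thesis
    using assms
    by (intro d_alpha_eqI[OF d_alpha_h])
      (auto intro!: derivative_eq_intros, simp add: divide_simps, algebra)
qed

lemma d_beta_alpha_h:
  assumes "0 < s" "s < t"
  shows "d_beta (d_alpha h) s t = (t ^ 3 - 3 * s * t\<^sup>2) / (t - s) ^ 3"
proof -
  have "t - s \<noteq> 0" "t \<noteq> s" using assms by auto
  then show ?thesis
    using assms
    by (intro d_beta_eqI[OF d_alpha_h])
      (auto intro!: derivative_eq_intros, simp add: divide_simps, algebra)
qed

lemma d_beta_beta_h:
  assumes "0 < s" "s < t"
  shows "d_beta (d_beta h) s t = 2 * s ^ 3 / (t - s) ^ 3"
proof -
  have "t - s \<noteq> 0" "t \<noteq> s" using assms by auto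
  then show ?thesis
    using assms
    by (intro d_beta_eqI[OF d_beta_h])
      (auto intro!: derivative_eq_intros, simp add: divide_simps, algebra)
qed

lemma d_alpha_alpha_alpha_h:
  assumes "0 < s" "s < t"
  shows "d_alpha (d_alpha (d_alpha h)) s t = 6 * t ^ 3 / (t - s) ^ 4"
proof -
  have "t - s \<noteq> 0" "t \<noteq> s" using assms by auto
  then show ?thesis
    using assms
    by (intro d_alpha_eqI[OF d_alpha_alpha_h])
      (auto intro!: derivative_eq_intros, simp add: divide_simps)
qed

text \<open>All second partial derivatives are homogeneous of degree 0, so by Euler's identity
  trading one \<alpha>-derivative for a \<beta>-derivative multiplies a third-order derivative by
  \<open>- s / t\<close>. This links the four third-order formulas.\<close>

lemma d_beta_alpha_alpha_h:
  assumes "0 < s" "s < t"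
  shows "d_beta (d_alpha (d_alpha h)) s t = - 6 * s * t\<^sup>2 / (t - s) ^ 4"
proof -
  have "t - s \<noteq> 0" "t \<noteq> s" using assms by auto
  then show ?thesis
    using assms
    by (intro d_beta_eqI[OF d_alpha_alpha_h])
      (auto intro!: derivative_eq_intros, simp add: divide_simps, algebra)
qed

lemma d_beta_beta_alpha_h:
  assumes "0 < s" "s < t"
  shows "d_beta (d_beta (d_alpha h)) s t = 6 * s\<^sup>2 * t / (t - s) ^ 4"
proof -
  have "t - s \<noteq> 0" "t \<noteq> s" using assms by auto
  then show ?thesis
    using assms
    by (intro d_beta_eqI[OF d_beta_alpha_h])
      (auto intro!: derivative_eq_intros, simp add: divide_simps, algebra)
qed

lemma d_beta_beta_beta_h:
  assumes "0 < s" "s < t"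
  shows "d_beta (d_beta (d_beta h)) s t = - 6 * s ^ 3 / (t - s) ^ 4"
proof -
  have "t - s \<noteq> 0" "t \<noteq> s" using assms by auto
  then show ?thesis
    using assms
    by (intro d_beta_eqI[OF d_beta_beta_h])
      (auto intro!: derivative_eq_intros, simp add: divide_simps)
qed

end

theorem theorem5p1:
  fixes A :: "('m::{t2_space, second_countable_topology}, 'n::finite) chart set"
    and a :: "('m, 'n) cometric_field"
    and b :: "('m, 'n) vector_field"
    and h :: "real \<Rightarrow> real \<Rightarrow> real"
    and H :: "'m \<Rightarrow> ('m, 'n) covector \<Rightarrow> real"
  assumes "cartan_space_ab A (ab_region A a b) a b h H"
    and "\<And>s t. 0 < s \<Longrightarrow> s < t \<Longrightarrow> h s t = s * t\<^sup>2 / (t - s)"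
  shows "\<forall>(p, \<omega>) \<in> ab_region A a b.
    let \<alpha> = alpha A a p \<omega>; \<beta> = beta A b p \<omega> in
      rho1 h \<alpha> \<beta> = (\<alpha> * \<beta>\<^sup>2 - 2 * \<alpha>\<^sup>2 * \<beta>) / (2 * (\<beta> - \<alpha>)\<^sup>2) \<and>
      rho h \<alpha> \<beta> = \<beta> ^ 3 / (2 * \<alpha> * (\<beta> - \<alpha>)\<^sup>2) \<and>
      rho0 h \<alpha> \<beta> = \<alpha> ^ 3 / (\<beta> - \<alpha>) ^ 3 \<and>
      rho_minus1 h \<alpha> \<beta> = (\<beta> ^ 3 - 3 * \<alpha> * \<beta>\<^sup>2) / (2 * \<alpha> * (\<beta> - \<alpha>) ^ 3) \<and>
      rho_minus2 h \<alpha> \<beta> = \<beta> ^ 3 * (3 * \<alpha> - \<beta>) / (2 * \<alpha> ^ 3 * (\<beta> - \<alpha>) ^ 3) \<and>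
      r_minus1 h \<alpha> \<beta> = - 3 * \<alpha> ^ 3 / (\<beta> - \<alpha>) ^ 4 \<and>
      r_minus2 h \<alpha> \<beta> = 3 * \<alpha> * \<beta> / (\<beta> - \<alpha>) ^ 4 \<and>
      r_minus3 h \<alpha> \<beta> =
        (4 * \<alpha> * \<beta> ^ 3 - \<beta> ^ 4 - 9 * \<alpha>\<^sup>2 * \<beta>\<^sup>2) / (2 * \<alpha> ^ 3 * (\<beta> - \<alpha>) ^ 4) \<and>
      r_minus4 h \<alpha> \<beta> =
        (15 * \<alpha>\<^sup>2 * \<beta> ^ 3 + 3 * \<beta> ^ 5 - 12 * \<alpha> * \<beta> ^ 4) / (2 * \<alpha> ^ 5 * (\<beta> - \<alpha>) ^ 4) \<and>
      \<alpha>\<^sup>2 * rho_minus1 h \<alpha> \<beta> + \<beta> * rho0 h \<alpha> \<beta> = rho1 h \<alpha> \<beta> \<and>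
      \<alpha>\<^sup>2 * rho_minus2 h \<alpha> \<beta> + \<beta> * rho_minus1 h \<alpha> \<beta> = 0 \<and>
      \<alpha>\<^sup>2 * r_minus2 h \<alpha> \<beta> + \<beta> * r_minus1 h \<alpha> \<beta> = 0 \<and>
      \<alpha>\<^sup>2 * r_minus3 h \<alpha> \<beta> + \<beta> * r_minus2 h \<alpha> \<beta> = - rho_minus1 h \<alpha> \<beta> \<and>
      \<alpha>\<^sup>2 * r_minus4 h \<alpha> \<beta> + \<beta> * r_minus3 h \<alpha> \<beta> = - 2 * rho_minus2 h \<alpha> \<beta>"
proof (clarify, goal_cases)
  case (1 p \<omega>)
  define s t where "s = alpha A a p \<omega>" and "t = beta A b p \<omega>"
  have "riemannian_cometric A a"
    using assms(1) by (simp add: cartan_space_ab_def)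
  \<comment> \<open>The region supplies only \<open>s < t\<close>; \<open>0 < s\<close> comes from
    removal of the zero section. The point thus lies in the cone where \<open>h\<close> is
    known.\<close>
  with 1 have st: "0 < s" "s < t"
    by (auto simp: ab_region_def s_def t_def intro: alpha_pos)
  have nz: "s \<noteq> 0" "t \<noteq> s" "t - s \<noteq> 0"
    using st by auto
  interpret fundamental_function h
    by unfold_locales (rule assms(2))
  note D = d_alpha_h[OF st] d_beta_h[OF st] d_alpha_alpha_h[OF st]
    d_beta_alpha_h[OF st] d_beta_beta_h[OF st] d_alpha_alpha_alpha_h[OF st]
    d_beta_alpha_alpha_h[OF st] d_beta_beta_alpha_h[OF st]
    d_beta_beta_beta_h[OF st]
  have rho1: "rho1 h s t = (s * t\<^sup>2 - 2 * s\<^sup>2 * t) / (2 * (t - s)\<^sup>2)"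
    unfolding rho1_def D using nz by (simp add: divide_simps) algebra
  have rho: "rho h s t = t ^ 3 / (2 * s * (t - s)\<^sup>2)"
    unfolding rho_def D using nz by simp
  have rho0: "rho0 h s t = s ^ 3 / (t - s) ^ 3"
    unfolding rho0_def D by simp
  have rho_minus1: "rho_minus1 h s t = (t ^ 3 - 3 * s * t\<^sup>2) / (2 * s * (t - s) ^ 3)"
    unfolding rho_minus1_def D by simp
  \<comment> \<open>The factor \<open>3 * s - t\<close> is \<open>2 * s - (t - s)\<close>, from the
    common denominator \<open>s * (t - s) ^ 3\<close>.\<close>
  have rho_minus2: "rho_minus2 h s t = t ^ 3 * (3 * s - t) / (2 * s ^ 3 * (t - s) ^ 3)"
    unfolding rho_minus2_def D using nz by (simp add: divide_simps) algebra
  have r_minus1: "r_minus1 h s t = - 3 * s ^ 3 / (t - s) ^ 4"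
    unfolding r_minus1_def D by simp
  have r_minus2: "r_minus2 h s t = 3 * s * t / (t - s) ^ 4"
    unfolding r_minus2_def D using nz by (simp add: divide_simps) algebra
  have r_minus3: "r_minus3 h s t =
      (4 * s * t ^ 3 - t ^ 4 - 9 * s\<^sup>2 * t\<^sup>2) / (2 * s ^ 3 * (t - s) ^ 4)"
    unfolding r_minus3_def D using nz by (simp add: divide_simps) algebra
  have r_minus4: "r_minus4 h s t =
      (15 * s\<^sup>2 * t ^ 3 + 3 * t ^ 5 - 12 * s * t ^ 4) / (2 * s ^ 5 * (t - s) ^ 4)"
    unfolding r_minus4_def D using nz by (simp add: divide_simps) algebra
  note inv = rho1 rho rho0 rho_minus1 rho_minus2 r_minus1 r_minus2 r_minus3 r_minus4
  \<comment> \<open>The five relations express Euler's identity for the first and second partial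
    derivatives of \<open>h\<close>, homogeneous of degrees 1 and 0; here they are checked directly
    on the closed forms.\<close>
  have rel1: "s\<^sup>2 * rho_minus1 h s t + t * rho0 h s t = rho1 h s t"
    unfolding inv using nz by (simp add: divide_simps) algebra
  have rel2: "s\<^sup>2 * rho_minus2 h s t + t * rho_minus1 h s t = 0"
    unfolding inv using nz by (simp add: divide_simps) algebra
  have rel3: "s\<^sup>2 * r_minus2 h s t + t * r_minus1 h s t = 0"
    unfolding inv using nz by (simp add: divide_simps) algebra
  have rel4: "s\<^sup>2 * r_minus3 h s t + t * r_minus2 h s t = - rho_minus1 h s t"
    unfolding inv using nz by (simp add: divide_simps) algebra
  have rel5: "s\<^sup>2 * r_minus4 h s t + t * r_minus3 h s t = - 2 * rho_minus2 h s t"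
    unfolding inv using nz by (simp add: divide_simps) algebra
  show ?case
    unfolding Let_def s_def[symmetric] t_def[symmetric]
    by (intro conjI inv rel1 rel2 rel3 rel4 rel5)
qed

end
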